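(* Let $(a(n))$ be the almost Golomb sequence of order $4$ and, for $n\ge 5$, define integers $\varepsilon_0(n),\dots,\varepsilon_3(n)$ by $$\varepsilon_0(n)=a(4n)-\bigl(a(n-3)+a(n-2)+a(n-1)+a(n)\bigr)-1,$$ $$\varepsilon_1(n)=a(4n+1)-\bigl(a(n-2)+a(n-1)+a(n)+a(n+1)\bigr),$$ $$\varepsilon_2(n)=a(4n+2)-\bigl(a(n-2)+a(n-1)+a(n)+a(n+1)\bigr),$$ $$\varepsilon_3(n)=a(4n+3)-\bigl(a(n-1)+a(n)+a(n+1)+a(n+2)\bigr)+1.$$ Their values for $n=5,6,\dots,23$ (in this order) are: $\varepsilon_0$: $0,1,1,1,1,1,1,1,1,1,1,1,0,1,0,1,1,0,1$; $\varepsilon_1$: $1,0,0,0,0,0,0,0,0,0,0,0,1,0,1,0,0,1,0$; $\varepsilon_2$: $1,1,1,1,1,1,1,1,1,1,1,0,1,0,1,1,0,1,0$; $\varepsilon_3$: $0,0,0,0,0,0,0,0,0,0,0,1,0,1,0,0,1,0,1$. Moreover, for every integer $m\ge 6$: $$\varepsilon_0(4m)=(1-\varepsilon_0(m))\varepsilon_0(m+1)+\varepsilon_0(m)\varepsilon_0(m-1),\quad \varepsilon_0(4m+1)=(1-\varepsilon_0(m))\varepsilon_0(m-1)+\varepsilon_0(m)\varepsilon_0(m+1),$$ $$\varepsilon_0(4m+2)=\varepsilon_0(m),\quad \varepsilon_0(4m+3)=\varepsilon_0(m+1),$$ $$\varepsilon_1(4m)=\varepsilon_2(m)\bigl(\varepsilon_1(m-1)\oplus\varepsilon_1(m+1)\bigr),\quad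 \varepsilon_1(4m+1)=1-\varepsilon_2(m),\quad \varepsilon_1(4m+2)=\varepsilon_1(m),\quad \varepsilon_1(4m+3)=\varepsilon_1(m+1),$$ $$\varepsilon_2(4m)=(1-\varepsilon_0(m-1))\varepsilon_1(m-1)+\varepsilon_0(m-1)(1-\varepsilon_1(m-1))\varepsilon_2(m),$$ $$\varepsilon_2(4m+1)=\varepsilon_2(m-1),\quad \varepsilon_2(4m+2)=\varepsilon_2(m),\quad \varepsilon_2(4m+3)=1-\varepsilon_1(m),$$ $$\varepsilon_3(4m)=\varepsilon_2(m-1)\bigl(\varepsilon_2(m)\equiv\varepsilon_1(m)\bigr),\quad \varepsilon_3(4m+1)=\varepsilon_3(m-1),\quad \varepsilon_3(4m+2)=\varepsilon_3(m),$$ $$\varepsilon_3(4m+3)=(1-\varepsilon_1(m+1))\bigl(\varepsilon_2(m)\equiv\varepsilon_1(m)\bigr).$$ In particular, $\varepsilon_i(n)\in\{0,1\}$ for all $n\ge 5$ and $i=0,1,2,3$, and each $\varepsilon_i$ is $4$-automatic.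
   Context: Consider nondecreasing sequences of positive integers $(a(n))_{n\ge 1}$, extended by $a(k)=0$ for $k\le 0$, such that (1) $a\bigl(a(n)+a(n-1)+a(n-2)+a(n-3)\bigr)=n$ for every $n\ge 1$; and (2) for every $n\ge 2$, no integer $m$ with $a(n-1)\le m<a(n)$ satisfies $a\bigl(m+a(n-1)+a(n-2)+a(n-3)\bigr)=n$. The almost Golomb sequence of order $4$ is the earliest such sequence, i.e. the lexicographically smallest among the sequences satisfying (1) and (2). It begins $1,2,2,2,3,3,4,4,5,6,6,7,7,8,8,9,9,9,10,10,11,11,11,12,\ldots$ For bits $x,y\in\{0,1\}$: $x\oplus y:=x+y-2xy$ (XOR) and $(x\equiv y):=1-x-y+2xy$ (XNOR). A sequence $(f(n))_{n\ge0}$ with values in a finite set is $4$-automatic if its $4$-kernel $\{(f(4^i n+j))_{n\ge 0}: i\ge 0,\ 0\le j<4^i\}$ is finite; the values $\varepsilon_i(n)$ for $0\le n<5$ are irrelevant and may be set to $0$.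
   Formalization: Condition (2) in the definition of the almost Golomb sequence is imposed for n ≥ 3 instead of n ≥ 2: condition (1) forces a(1)=1, a(2)=2, and then m=1 violates (2) at n=2, so no sequence satisfies the conditions as literally stated. *)

theory Defs
  imports Main "HOL-Library.Fun_Lexorder"
begin

definition golomb4_ext :: "(int \<Rightarrow> int) \<Rightarrow> bool" where
  "golomb4_ext a \<longleftrightarrow>
     (\<forall>k\<le>0. a k = 0) \<and> (\<forall>k\<ge>1. a k > 0) \<and> (\<forall>j\<ge>1. \<forall>k\<ge>j. a j \<le> a k)"

definition golomb4_cond1 :: "(int \<Rightarrow> int) \<Rightarrow> bool" where
  "golomb4_cond1 a \<longleftrightarrow> (\<forall>n\<ge>1. a (a n + a (n - 1) + a (n - 2) + a (n - 3)) = n)"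

definition golomb4_cond2 :: "(int \<Rightarrow> int) \<Rightarrow> int \<Rightarrow> bool" where
  "golomb4_cond2 a n \<longleftrightarrow>
     \<not> (\<exists>m. a (n - 1) \<le> m \<and> m < a n \<and> a (m + a (n - 1) + a (n - 2) + a (n - 3)) = n)"

text \<open>
  The second condition is imposed for \<open>n \<ge> 3\<close> only.  At \<open>n = 2\<close> it is incompatible with the
  first one, as the next lemma shows: the first condition forces \<open>a(1) = 1\<close> and \<open>a(2) = a(3) = 2\<close>,
  and then \<open>m = 1\<close> satisfies \<open>a(m + a(1)) = 2\<close>.  The sequence 1, 2, 2, 2, 3, 3, 4, 4, 5, ...
  itself violates the condition at \<open>n = 2\<close>.
\<close>

lemma golomb4_cond2_fails_at_2:
  assumes ext: "golomb4_ext a" and c1: "golomb4_cond1 a"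
  shows "\<not> golomb4_cond2 a 2"
proof -
  have zero: "a k = 0" if "k \<le> 0" for k using ext that by (auto simp: golomb4_ext_def)
  have pos: "a k \<ge> 1" if "k \<ge> 1" for k using ext that by (force simp: golomb4_ext_def)
  have mon: "a j \<le> a k" if "1 \<le> j" "j \<le> k" for j k
    using ext that by (auto simp: golomb4_ext_def)
  have eq: "a (a n + a (n - 1) + a (n - 2) + a (n - 3)) = n" if "n \<ge> 1" for n
    using c1 that by (auto simp: golomb4_cond1_def)
  have "a (a 1) = 1" using eq[of 1] by (simp add: zero)
  then have a1: "a 1 = 1" using pos[of 1] mon[of 1 "a 1"] by simp
  have e2: "a (a 2 + 1) = 2" using eq[of 2] by (simp add: zero a1)
  have le: "a 2 \<le> 2" using e2 mon[of 2 "a 2 + 1"] pos[of 2] by simp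
  have "a 2 \<noteq> 1" using e2 by auto
  with le pos[of 2] have a2: "a 2 = 2" by simp
  show ?thesis unfolding golomb4_cond2_def
    using a1 a2 by (auto simp: zero intro!: exI[of _ 1])
qed

definition golomb4_admissible :: "(int \<Rightarrow> int) \<Rightarrow> bool" where
  "golomb4_admissible a \<longleftrightarrow>
     golomb4_ext a \<and> golomb4_cond1 a \<and> (\<forall>n\<ge>3. golomb4_cond2 a n)"

text \<open>
  Admissible functions agree on \<open>k \<le> 0\<close>, so \<^const>\<open>less_fun\<close> on \<^typ>\<open>int \<Rightarrow> int\<close> compares
  them at the first positive index where they differ.
\<close>

definition golomb4_earliest :: "(int \<Rightarrow> int) \<Rightarrow> bool" where
  "golomb4_earliest a \<longleftrightarrow>
     golomb4_admissible a \<and> (\<forall>b. golomb4_admissible b \<longrightarrow> b = a \<or> less_fun a b)"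

lemma golomb4_earliest_unique:
  assumes "golomb4_earliest a" "golomb4_earliest b"
  shows "a = b"
  using assms less_fun_asym[of a b] unfolding golomb4_earliest_def by blast

definition almost_golomb4 :: "int \<Rightarrow> int" where
  "almost_golomb4 = (THE a. golomb4_earliest a)"

definition eps0 :: "int \<Rightarrow> int" where
  "eps0 n = (let a = almost_golomb4 in
     if n \<ge> 5 then a (4*n) - (a (n - 3) + a (n - 2) + a (n - 1) + a n) - 1 else 0)"

definition eps1 :: "int \<Rightarrow> int" where
  "eps1 n = (let a = almost_golomb4 in
     if n \<ge> 5 then a (4*n + 1) - (a (n - 2) + a (n - 1) + a n + a (n + 1)) else 0)"

definition eps2 :: "int \<Rightarrow> int" where
  "eps2 n = (let a = almost_golomb4 in
     if n \<ge> 5 then a (4*n + 2) - (a (n - 2) + a (n - 1) + a n + a (n + 1)) else 0)"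

definition eps3 :: "int \<Rightarrow> int" where
  "eps3 n = (let a = almost_golomb4 in
     if n \<ge> 5 then a (4*n + 3) - (a (n - 1) + a n + a (n + 1) + a (n + 2)) + 1 else 0)"

definition bit_xor :: "int \<Rightarrow> int \<Rightarrow> int" where
  "bit_xor x y = x + y - 2 * x * y"

definition bit_xnor :: "int \<Rightarrow> int \<Rightarrow> int" where
  "bit_xnor x y = 1 - x - y + 2 * x * y"

definition automatic_kernel :: "nat \<Rightarrow> (nat \<Rightarrow> 'a) \<Rightarrow> (nat \<Rightarrow> 'a) set" where
  "automatic_kernel k f = {\<lambda>n. f (k ^ i * n + j) | i j. j < k ^ i}"

definition automatic :: "nat \<Rightarrow> (nat \<Rightarrow> 'a) \<Rightarrow> bool" where
  "automatic k f \<longleftrightarrow> finite (range f) \<and> finite (automatic_kernel k f)"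

end

theory Submission
  imports Defs "HOL-Library.FuncSet"
begin

text \<open>
  Write \<open>s(n) = a(n) + a(n-1) + a(n-2) + a(n-3)\<close>.  The two conditions say, apart from the first
  few indices, that the value \<open>n\<close> occurs at position \<open>s(n)\<close>, and that it occurs there for the
  first time whenever \<open>a\<close> has just increased.  Postponing each new value as long as possible gives
  the smallest sequence, so in the earliest sequence \<open>s(n)\<close> is the first position of \<open>n\<close>
  for \<open>n \<ge> 3\<close>.

  The proof does not start from this sequence but from its expected description.  The \<^emph>\<open>cell\<close>
  at \<open>n\<close> is the increment \<open>a(n) - a(n-1)\<close> together with \<open>\<epsilon>\<^sub>0(n), \<dots>, \<epsilon>\<^sub>3(n)\<close>.  The claimed
  recurrences for the \<open>\<epsilon>\<^sub>i\<close>, and the increments that the definition of the \<open>\<epsilon>\<^sub>i\<close> then forces,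
  express the cells at \<open>4m-2, \<dots>, 4m+1\<close> by the cells at \<open>m-2, \<dots>, m+1\<close> (\<open>block\<close>).  Taken as a
  definition, this rule yields a sequence of cells \<open>cell_at\<close> and, by summing increments, an integer
  sequence \<open>aseq\<close>; the recurrences hold by construction, and a telescoping argument shows that
  the \<open>\<epsilon>\<^sub>i\<close> computed from \<open>aseq\<close> are the components of the cells (\<open>aseq_4n\<close> and the three lemmas
  around it).  What remains is that \<open>aseq\<close> is the almost Golomb sequence.

  The main point is that \<open>aseq\<close> increases to the value \<open>n \<ge> 3\<close> exactly at \<open>s(n)\<close>.  By the same
  telescoping, \<open>s(4n+j) = 4 s(n) + \<delta>\<close>, where \<open>\<delta>\<close> depends only on \<open>j\<close> and the cells near \<open>n\<close>
  (\<open>pos_4n\<close>).  Hence the cells near \<open>4n+j\<close> and near \<open>s(4n+j)\<close> are determined by the cells near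
  \<open>n\<close> and near \<open>s(n)\<close>: the pair consisting of a window at \<open>n\<close> and a window at \<open>s(n)\<close> is the
  state of a finite automaton that reads the base-4 digits of \<open>n\<close>.  Only 43 states are reachable, and
  in each of them the window at \<open>s(n)\<close> shows an increment at \<open>s(n)\<close> and exactly one more up to
  \<open>s(n+1)\<close> (\<open>window_pair\<close>, \<open>aseq_pos\<close>).

  Minimality is a comparison at the first difference: a smaller sequence \<open>b\<close> would first deviate at
  some \<open>k = s(n)\<close> by not increasing there, but \<open>s(n)\<close> only involves terms below \<open>k\<close>, so the first
  condition for \<open>b\<close> demands \<open>b(k) = n\<close> (\<open>less_fun_aseq\<close>).  Finally, the windows at \<open>n\<close> are
  finitely many and the one at \<open>4n+j\<close> depends on the one at \<open>n\<close>, which gives automaticity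
  (\<open>automatic_if_state\<close>).
\<close>

section \<open>Cells and the sequence they generate\<close>

datatype cell = Cell (inc: int) (u0: int) (u1: int) (u2: int) (u3: int)

text \<open>
  Of the 32 conceivable cells of bits, only these seven occur.  A, B and C carry no increment.
\<close>
abbreviation A :: cell where "A \<equiv> Cell 0 0 1 1 0"
abbreviation B :: cell where "B \<equiv> Cell 0 1 0 0 1"
abbreviation C :: cell where "C \<equiv> Cell 0 1 0 1 0"
abbreviation D :: cell where "D \<equiv> Cell 1 0 0 1 1"
abbreviation E :: cell where "E \<equiv> Cell 1 0 1 1 0"
abbreviation F :: cell where "F \<equiv> Cell 1 1 0 0 1"
abbreviation G :: cell where "G \<equiv> Cell 1 1 0 1 0"

text \<open>
  If \<open>v, w, x, y\<close> are the cells at \<open>m-2, \<dots>, m+1\<close>, the result lists the cells at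
  \<open>4m-2, \<dots>, 4m+1\<close>.  The last four components are the recurrences of the theorem, taken at \<open>m-1\<close>
  for the first two cells.  The increments are differences of consecutive values \<open>a(4n+i)\<close>
  expressed through \<open>s\<close> and \<open>\<epsilon>\<^sub>i\<close>; for example
  \<open>a(4m) - a(4m-1) = (s(m) + 1 + \<epsilon>\<^sub>0(m)) - (s(m+1) - 1 + \<epsilon>\<^sub>3(m-1))\<close>.  Here
  \<open>r = s(m+1) - s(m) = a(m+1) - a(m-3)\<close> is the expected number of terms with value \<open>m\<close>.
\<close>
definition block :: "cell \<Rightarrow> cell \<Rightarrow> cell \<Rightarrow> cell \<Rightarrow> cell list" where
  "block v w x y =
    (let r = inc v + inc w + inc x + inc y in
     [Cell (u2 w - u1 w) (u0 w) (u1 w) (u2 w) (u3 w),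
      Cell (r - 1 + u3 w - u2 w)
        (u0 x) (u1 x) (1 - u1 w) ((1 - u1 x) * bit_xnor (u2 w) (u1 w)),
      Cell (2 + u0 x - u3 w - r)
        ((1 - u0 x) * u0 y + u0 x * u0 w)
        (u2 x * bit_xor (u1 w) (u1 y))
        ((1 - u0 w) * u1 w + u0 w * (1 - u1 w) * u2 x)
        (u2 w * bit_xnor (u2 x) (u1 x)),
      Cell (r + u1 x - 1 - u0 x)
        ((1 - u0 x) * u0 w + u0 x * u0 y) (1 - u2 x) (u2 w) (u3 w)])"

text \<open>
  Indices below 1 get the entry 0, which has no increment and so matches \<open>a(k) = 0\<close> there.  The
  entries 1, 2, 3 are only there for their increments.  Entry 4 is chosen so that the
  five cells around 6 already form one of the recurring windows.
\<close>
function cell_at :: "int \<Rightarrow> cell" where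
  "cell_at n =
    (if n < 24 then [C,G,F,A,B,E,C,G,C,G,G,C,G,C,G,C,F,A,B,E,C,F,A,B] ! nat n
     else let m = (n + 2) div 4 in
       block (cell_at (m - 2)) (cell_at (m - 1)) (cell_at m) (cell_at (m + 1))
         ! nat ((n + 2) mod 4))"
  by auto
termination by (relation "measure nat") auto

declare cell_at.simps [simp del]

definition aseq :: "int \<Rightarrow> int" where
  "aseq k = (\<Sum>i\<in>{1..k}. inc (cell_at i))"

text \<open>This is \<open>s(n)\<close>, which for \<open>n \<ge> 3\<close> will turn out to be the first index with value \<open>n\<close>.\<close>
definition pos :: "int \<Rightarrow> int" where
  "pos n = aseq n + aseq (n - 1) + aseq (n - 2) + aseq (n - 3)"

lemma aseq_nonpos: "k \<le> 0 \<Longrightarrow> aseq k = 0"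
  by (simp add: aseq_def)

lemma aseq_step:
  assumes "k \<ge> 1"
  shows "aseq k = aseq (k - 1) + inc (cell_at k)"
proof -
  have "{1..k} = insert k {1..k - 1}" using assms by auto
  then show ?thesis by (simp add: aseq_def)
qed

lemma pos_step:
  assumes "n \<ge> 3"
  shows "pos (n + 1) = pos n + inc (cell_at (n - 2)) + inc (cell_at (n - 1))
           + inc (cell_at n) + inc (cell_at (n + 1))"
  using assms aseq_step[of "n + 1"] aseq_step[of n] aseq_step[of "n - 1"] aseq_step[of "n - 2"]
  by (simp add: pos_def)

text \<open>
  The tabulated cells at 22 and 23 already obey the rule, so it holds for the whole block of \<open>m = 6\<close>.
\<close>
lemma block_cell_at:
  assumes "m \<ge> 6"
  shows "block (cell_at (m - 2)) (cell_at (m - 1)) (cell_at m) (cell_at (m + 1)) =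
    [cell_at (4 * m - 2), cell_at (4 * m - 1), cell_at (4 * m), cell_at (4 * m + 1)]"
proof (cases "m = 6")
  case True
  then show ?thesis by (simp add: cell_at.simps block_def bit_xor_def bit_xnor_def)
next
  case False
  then have m: "m \<ge> 7" using assms by simp
  have d: "(4 * m - 2 + 2) div 4 = m" "(4 * m - 1 + 2) div 4 = m"
    "(4 * m + 2) div 4 = m" "(4 * m + 1 + 2) div 4 = m"
    "(4 * m - 2 + 2) mod 4 = 0" "(4 * m - 1 + 2) mod 4 = 1"
    "(4 * m + 2) mod 4 = 2" "(4 * m + 1 + 2) mod 4 = 3" by presburger+
  show ?thesis
    using m
    apply (subst cell_at.simps[of "4 * m - 2"])
    apply (subst cell_at.simps[of "4 * m - 1"])
    apply (subst cell_at.simps[of "4 * m"])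
    apply (subst cell_at.simps[of "4 * m + 1"])
    apply (simp only: d Let_def)
    apply (simp add: block_def Let_def)
    done
qed

lemma
  assumes "m \<ge> 6"
  shows cell_at_4m_minus_2: "cell_at (4 * m - 2) =
      block (cell_at (m - 2)) (cell_at (m - 1)) (cell_at m) (cell_at (m + 1)) ! 0"
    and cell_at_4m_minus_1: "cell_at (4 * m - 1) =
      block (cell_at (m - 2)) (cell_at (m - 1)) (cell_at m) (cell_at (m + 1)) ! 1"
    and cell_at_4m: "cell_at (4 * m) =
      block (cell_at (m - 2)) (cell_at (m - 1)) (cell_at m) (cell_at (m + 1)) ! 2"
    and cell_at_4m_plus_1: "cell_at (4 * m + 1) =
      block (cell_at (m - 2)) (cell_at (m - 1)) (cell_at m) (cell_at (m + 1)) ! 3"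
  using block_cell_at[OF assms] by simp_all

lemmas cell_at_rec = cell_at_4m_minus_2 cell_at_4m_minus_1 cell_at_4m cell_at_4m_plus_1

section \<open>The terms at 4n, ..., 4n + 3\<close>

text \<open>
  The increments in \<open>block\<close> are made for these four formulas; one of them is carried from \<open>n\<close> to
  \<open>n+1\<close> by summing four increments, and the others differ from it by one or two increments.
\<close>

lemma aseq_4n_plus_1:
  "n \<ge> 5 \<Longrightarrow> aseq (4 * n + 1) = pos (n + 1) + u1 (cell_at n)"
proof (induction n rule: int_ge_induct)
  case base
  show ?case by (simp add: pos_def aseq_step aseq_nonpos cell_at.simps)
next
  case (step n)
  have "aseq (4 * n + 5) = aseq (4 * n + 1) + inc (cell_at (4 * n + 2)) + inc (cell_at (4 * n + 3))
      + inc (cell_at (4 * n + 4)) + inc (cell_at (4 * n + 5))"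
    using step.hyps aseq_step[of "4 * n + 5"] aseq_step[of "4 * n + 4"] aseq_step[of "4 * n + 3"]
      aseq_step[of "4 * n + 2"] by (simp add: algebra_simps)
  moreover have "pos (n + 2) = pos (n + 1) + inc (cell_at (n - 1)) + inc (cell_at n)
           + inc (cell_at (n + 1)) + inc (cell_at (n + 2))"
    using step.hyps pos_step[of "n + 1"] by (simp add: add.commute)
  ultimately show ?case
    using step cell_at_rec[of "n + 1"] by (simp add: block_def Let_def algebra_simps)
qed

lemma aseq_4n:
  assumes "n \<ge> 5"
  shows "aseq (4 * n) = pos n + 1 + u0 (cell_at n)"
proof (cases "n = 5")
  case True
  then show ?thesis by (simp add: pos_def aseq_step aseq_nonpos cell_at.simps)
next
  case False
  then show ?thesis
    using assms aseq_4n_plus_1[of n] aseq_step[of "4 * n + 1"] cell_at_4m_plus_1[of n] pos_step[of n]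
    by (simp add: block_def Let_def)
qed

lemma aseq_4n_plus_2:
  assumes "n \<ge> 5"
  shows "aseq (4 * n + 2) = pos (n + 1) + u2 (cell_at n)"
  using assms aseq_4n_plus_1[of n] aseq_step[of "4 * n + 2"] cell_at_4m_minus_2[of "n + 1"]
  by (simp add: block_def Let_def algebra_simps)

lemma aseq_4n_plus_3:
  assumes "n \<ge> 5"
  shows "aseq (4 * n + 3) = pos (n + 2) - 1 + u3 (cell_at n)"
  using assms aseq_4n_plus_2[of n] aseq_step[of "4 * n + 3"] cell_at_4m_minus_1[of "n + 1"]
    pos_step[of "n + 1"]
  by (simp add: block_def Let_def algebra_simps)

section \<open>Windows of cells\<close>

definition window :: "int \<Rightarrow> nat \<Rightarrow> cell list" where
  "window i l = map (\<lambda>k. cell_at (i + int k)) [0..<l]"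

lemma length_window [simp]: "length (window i l) = l"
  by (simp add: window_def)

lemma nth_window [simp]: "k < l \<Longrightarrow> window i l ! k = cell_at (i + int k)"
  by (simp add: window_def)

lemma window_0 [simp]: "window i 0 = []"
  by (simp add: window_def)

lemma window_Suc: "window i (Suc l) = cell_at i # window (i + 1) l"
  by (simp add: window_def map_upt_Suc algebra_simps del: upt_Suc)

lemma take_drop_window:
  "j + l \<le> k \<Longrightarrow> take l (drop j (window i k)) = window (i + int j) l"
  by (rule nth_equalityI) (auto simp: algebra_simps)

text \<open>
  A word of \<open>l + 3\<close> consecutive cells has \<open>l\<close> overlapping subwords of length 4; their blocks are
  adjacent and form a word of \<open>4l\<close> cells.
\<close>
fun image_word :: "cell list \<Rightarrow> cell list" where
  "image_word (v # w # x # y # zs) = block v w x y @ image_word (w # x # y # zs)"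
| "image_word _ = []"

lemma image_window:
  "i \<ge> 4 \<Longrightarrow> image_word (window i (l + 3)) = window (4 * i + 6) (4 * l)"
proof (induction l arbitrary: i)
  case 0
  show ?case by (simp add: window_Suc numeral_3_eq_3)
next
  case (Suc l)
  have eq: "window i (Suc l + 3)
      = cell_at i # cell_at (i + 1) # cell_at (i + 2) # cell_at (i + 3) # window (i + 4) l"
    by (simp add: window_Suc numeral_3_eq_3 add.assoc)
  have "image_word (window i (Suc l + 3))
      = block (cell_at i) (cell_at (i + 1)) (cell_at (i + 2)) (cell_at (i + 3))
        @ image_word (window (i + 1) (l + 3))"
    unfolding eq by (simp add: window_Suc numeral_3_eq_3 add.assoc)
  also have "image_word (window (i + 1) (l + 3)) = window (4 * i + 10) (4 * l)"
    using Suc.IH[of "i + 1"] Suc.prems by (simp add: add.commute)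
  also have "block (cell_at i) (cell_at (i + 1)) (cell_at (i + 2)) (cell_at (i + 3))
      = [cell_at (4 * i + 6), cell_at (4 * i + 7), cell_at (4 * i + 8), cell_at (4 * i + 9)]"
    using block_cell_at[of "i + 2"] Suc.prems by (simp add: algebra_simps)
  also have "\<dots> @ window (4 * i + 10) (4 * l) = window (4 * i + 6) (4 * Suc l)"
  proof -
    have "4 * Suc l = Suc (Suc (Suc (Suc (4 * l))))" by simp
    then show ?thesis by (simp only: window_Suc) (simp add: add.assoc)
  qed
  finally show ?case .
qed

section \<open>The finite automaton\<close>

text \<open>
  The states: the cells at \<open>n-2, \<dots>, n+2\<close>, paired with those at \<open>s(n)-2, \<dots>, s(n)+6\<close>.
  The second window is part of the state because the first does not determine it: C G C G C occurs
  with three partners.  The sizes are such that the windows reproduce themselves.  The image of the first one covers \<open>4n-2, \<dots>, 4n+5\<close>, which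
  is just what the windows of \<open>4n, \<dots>, 4n+3\<close> need; the image of the second one covers
  \<open>4 s(n) - 2, \<dots>, 4 s(n) + 21\<close>, which contains the window at \<open>4 s(n) + \<delta>\<close> for
  \<open>0 \<le> \<delta> \<le> 15\<close>.
\<close>
definition pairs :: "(cell list \<times> cell list) list" where
  "pairs = [
   ([A,B,D,A,B], [G,C,G,G,G,C,G,G,C]),
   ([A,B,D,A,B], [G,C,G,G,G,C,G,G,G]),
   ([A,B,E,C,F], [G,C,G,G,C,G,C,G,G]),
   ([A,B,E,C,G], [G,C,G,G,C,G,C,G,C]),
   ([B,D,A,B,D], [C,G,G,G,C,G,G,G,C]),
   ([B,D,A,B,E], [C,G,G,G,C,G,G,C,G]),
   ([B,E,C,F,A], [C,G,G,C,G,C,G,G,C]),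
   ([B,E,C,G,C], [C,G,G,C,G,C,G,C,F]),
   ([B,E,C,G,C], [C,G,G,C,G,C,G,C,G]),
   ([C,F,A,B,D], [G,C,G,G,C,G,G,G,C]),
   ([C,F,A,B,E], [G,C,G,G,C,G,G,C,G]),
   ([C,G,C,F,A], [G,C,G,C,G,C,G,G,C]),
   ([C,G,C,G,C], [E,C,G,C,G,C,G,C,G]),
   ([C,G,C,G,C], [G,C,G,C,G,C,G,C,F]),
   ([C,G,C,G,C], [G,C,G,C,G,C,G,C,G]),
   ([C,G,C,G,G], [E,C,G,C,F,A,B,E,C]),
   ([C,G,C,G,G], [G,C,G,C,F,A,B,E,C]),
   ([C,G,G,C,G], [A,B,E,C,F,A,B,D,A]),
   ([C,G,G,C,G], [A,B,E,C,F,A,B,E,C]),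
   ([C,G,G,G,C], [A,B,D,A,B,D,A,B,D]),
   ([D,A,B,D,A], [G,G,G,C,G,G,G,C,G]),
   ([D,A,B,E,C], [G,G,G,C,G,G,C,G,C]),
   ([E,C,F,A,B], [G,C,G,C,G,G,C,G,G]),
   ([E,C,G,C,F], [G,C,G,C,G,C,G,C,G]),
   ([E,C,G,C,G], [G,C,G,C,G,C,F,A,B]),
   ([E,C,G,C,G], [G,C,G,C,G,C,G,C,G]),
   ([F,A,B,D,A], [C,G,G,C,G,G,G,C,G]),
   ([F,A,B,E,C], [C,G,G,C,G,G,C,G,C]),
   ([G,C,F,A,B], [G,C,G,C,G,G,C,G,G]),
   ([G,C,G,C,F], [G,C,G,C,G,C,G,C,G]),
   ([G,C,G,C,G], [A,B,E,C,G,C,F,A,B]),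
   ([G,C,G,C,G], [A,B,E,C,G,C,G,C,G]),
   ([G,C,G,C,G], [G,C,G,C,G,C,F,A,B]),
   ([G,C,G,C,G], [G,C,G,C,G,C,G,C,G]),
   ([G,C,G,G,C], [A,B,D,A,B,E,C,F,A]),
   ([G,C,G,G,C], [G,C,F,A,B,E,C,F,A]),
   ([G,C,G,G,G], [A,B,D,A,B,D,A,B,D]),
   ([G,G,C,G,C], [E,C,F,A,B,E,C,G,C]),
   ([G,G,C,G,G], [A,B,D,A,B,D,A,B,D]),
   ([G,G,C,G,G], [A,B,D,A,B,D,A,B,E]),
   ([G,G,C,G,G], [E,C,F,A,B,D,A,B,D]),
   ([G,G,C,G,G], [E,C,F,A,B,D,A,B,E]),
   ([G,G,G,C,G], [A,B,D,A,B,D,A,B,D])]"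

text \<open>
  The four values \<open>s(4n+j) - 4 s(n)\<close> in terms of the cells at \<open>n-2, \<dots>, n+2\<close>, obtained by adding up
  four consecutive terms of the form \<open>a(4n+i)\<close>; here \<open>r\<close> and \<open>r'\<close> are \<open>s(n+1) - s(n)\<close> and
  \<open>s(n+2) - s(n+1)\<close>.
\<close>
fun shifts :: "cell list \<Rightarrow> int list" where
  "shifts [v, w, x, y, z] =
    (let r = inc v + inc w + inc x + inc y; r' = inc w + inc x + inc y + inc z in
      [r + u0 x + u1 w + u2 w + u3 w,
       2 * r + u0 x + u1 x + u2 w + u3 w,
       3 * r + u0 x + u1 x + u2 x + u3 w,
       3 * r + r' + u0 x + u1 x + u2 x + u3 x])"
| "shifts _ = []"

text \<open>The transition of the automaton from the state at \<open>n\<close> to the state at \<open>4n+j\<close>.\<close>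
definition descend :: "nat \<Rightarrow> cell list \<times> cell list \<Rightarrow> cell list \<times> cell list" where
  "descend j p = (take 5 (drop j (image_word (fst p))),
     take 9 (drop (nat (shifts (fst p) ! j)) (image_word (snd p))))"


lemma pairs_closed:
  "list_all (\<lambda>p. list_all (\<lambda>j. descend j p \<in> set pairs \<and>
       0 \<le> shifts (fst p) ! j \<and> shifts (fst p) ! j \<le> 15) [0, 1, 2, 3]) pairs"
  by code_simp

definition bits :: "cell \<Rightarrow> bool" where
  "bits x \<longleftrightarrow> inc x \<in> {0, 1} \<and> u0 x \<in> {0, 1} \<and> u1 x \<in> {0, 1} \<and> u2 x \<in> {0, 1} \<and> u3 x \<in> {0, 1}"

text \<open>
  The local form of "the value \<open>n\<close> starts at \<open>s(n)\<close> and \<open>n+1\<close> starts at \<open>s(n+1)\<close>": the entry of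
  \<open>vs\<close> with index 2 is the cell at \<open>s(n)\<close>, and of the \<open>r = s(n+1) - s(n)\<close> cells after it
  exactly one has an increment.
\<close>
fun sound :: "cell list \<times> cell list \<Rightarrow> bool" where
  "sound (ws, vs) \<longleftrightarrow>
     (let r = inc (ws ! 0) + inc (ws ! 1) + inc (ws ! 2) + inc (ws ! 3) in
       list_all bits ws \<and> inc (vs ! 2) = 1 \<and>
       1 \<le> r \<and> r \<le> 3 \<and> (\<Sum>k\<leftarrow>[0..<nat r]. inc (vs ! (3 + k))) = 1)"

lemma pairs_sound: "list_all sound pairs"
  by code_simp

lemma pairs_start:
  "list_all (\<lambda>n. (window (n - 2) 5, window (pos n - 2) 9) \<in> set pairs \<and> n + 4 \<le> pos n) [6..23]"
  by code_simp

lemma small_cases: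
  assumes "1 \<le> n" "n \<le> 6"
  shows "inc (cell_at n) \<in> {0, 1}" and "aseq (pos n) = n"
    and "3 \<le> n \<Longrightarrow> inc (cell_at (pos n)) = 1" and "3 \<le> n \<Longrightarrow> n < pos n"
proof -
  have "list_all (\<lambda>n. inc (cell_at n) \<in> {0, 1} \<and> aseq (pos n) = n \<and>
      (3 \<le> n \<longrightarrow> inc (cell_at (pos n)) = 1 \<and> n < pos n)) [1..6]"
    by code_simp
  moreover have "n \<in> set [1..6]" using assms by (simp only: set_upto) simp
  ultimately show "inc (cell_at n) \<in> {0, 1}" and "aseq (pos n) = n"
    and "3 \<le> n \<Longrightarrow> inc (cell_at (pos n)) = 1" and "3 \<le> n \<Longrightarrow> n < pos n"
    unfolding list_all_iff by blast+
qed

lemma window_5: "window i 5 = [cell_at i, cell_at (i + 1), cell_at (i + 2), cell_at (i + 3), cell_at (i + 4)]"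
  by (simp add: window_Suc numeral_eq_Suc add.assoc)

lemma pos_4n:
  assumes "n \<ge> 6" "j < 4"
  shows "pos (4 * n + int j) = 4 * pos n + shifts (window (n - 2) 5) ! j"
proof -
  have a: "aseq (4 * n - 1) = pos (n + 1) - 1 + u3 (cell_at (n - 1))"
    "aseq (4 * n - 2) = pos n + u2 (cell_at (n - 1))"
    "aseq (4 * n - 3) = pos n + u1 (cell_at (n - 1))"
    "aseq (4 * n) = pos n + 1 + u0 (cell_at n)"
    "aseq (4 * n + 1) = pos (n + 1) + u1 (cell_at n)"
    "aseq (4 * n + 2) = pos (n + 1) + u2 (cell_at n)"
    "aseq (4 * n + 3) = pos (n + 2) - 1 + u3 (cell_at n)"
    using assms aseq_4n_plus_1[of "n - 1"] aseq_4n_plus_2[of "n - 1"] aseq_4n_plus_3[of "n - 1"]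
      aseq_4n[of n] aseq_4n_plus_1[of n] aseq_4n_plus_2[of n] aseq_4n_plus_3[of n]
    by (simp_all add: add.commute)
  have p: "pos (n + 1) = pos n + inc (cell_at (n - 2)) + inc (cell_at (n - 1))
           + inc (cell_at n) + inc (cell_at (n + 1))"
    "pos (n + 2) = pos (n + 1) + inc (cell_at (n - 1)) + inc (cell_at n)
           + inc (cell_at (n + 1)) + inc (cell_at (n + 2))"
    using assms pos_step[of n] pos_step[of "n + 1"] by (simp_all add: add.commute)
  have q: "pos (4 * n) = aseq (4 * n) + aseq (4 * n - 1) + aseq (4 * n - 2) + aseq (4 * n - 3)"
    "pos (4 * n + 1) = aseq (4 * n + 1) + aseq (4 * n) + aseq (4 * n - 1) + aseq (4 * n - 2)"
    "pos (4 * n + 2) = aseq (4 * n + 2) + aseq (4 * n + 1) + aseq (4 * n) + aseq (4 * n - 1)"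
    "pos (4 * n + 3) = aseq (4 * n + 3) + aseq (4 * n + 2) + aseq (4 * n + 1) + aseq (4 * n)"
    by (simp_all add: pos_def add.commute)
  have w: "window (n - 2) 5 =
      [cell_at (n - 2), cell_at (n - 1), cell_at n, cell_at (n + 1), cell_at (n + 2)]"
    by (simp add: window_5 add.commute)
  have "j = 0 \<or> j = 1 \<or> j = 2 \<or> j = 3" using assms by auto
  then show ?thesis
    by (elim disjE) (simp_all add: q w a p Let_def)
qed

lemma window_4n:
  assumes "n \<ge> 6" "j < 4"
  shows "window (4 * n + int j - 2) 5 = take 5 (drop j (image_word (window (n - 2) 5)))"
  using assms image_window[of "n - 2" 2] by (simp add: take_drop_window algebra_simps)

text \<open>
  Strong induction along \<open>n \<mapsto> n div 4\<close>.  The bound on \<open>s(n)\<close> keeps the window at \<open>s(n)\<close> in the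
  range where the block rule is valid, and shows later that \<open>s(n)\<close> lies beyond \<open>n\<close>.
\<close>
lemma window_pair:
  "n \<ge> 6 \<Longrightarrow> (window (n - 2) 5, window (pos n - 2) 9) \<in> set pairs \<and> n + 4 \<le> pos n"
proof (induction n rule: measure_induct_rule[where f = nat])
  case (less n)
  show ?case
  proof (cases "n < 24")
    case True
    then have "n \<in> set [6..23]" using less.prems by (simp only: set_upto) simp
    then show ?thesis using pairs_start unfolding list_all_iff by blast
  next
    case False
    define m j where "m = n div 4" and "j = nat (n mod 4)"
    have j: "j < 4" and n: "n = 4 * m + int j" and m: "m \<ge> 6" "nat m < nat n"
      using False by (auto simp: m_def j_def)
    define s where "s = shifts (window (m - 2) 5) ! j"
    have IH: "(window (m - 2) 5, window (pos m - 2) 9) \<in> set pairs" "m + 4 \<le> pos m"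
      using less.IH[OF m(2) m(1)] by auto
    have "j \<in> set [0, 1, 2, 3]" using j by auto
    with pairs_closed IH(1)
    have cl: "descend j (window (m - 2) 5, window (pos m - 2) 9) \<in> set pairs" and s: "0 \<le> s" "s \<le> 15"
      unfolding list_all_iff s_def by fastforce+
    have pos: "pos n = 4 * pos m + s" unfolding n s_def by (rule pos_4n[OF m(1) j])
    have "image_word (window (pos m - 2) 9) = window (4 * pos m - 2) 24"
      using image_window[of "pos m - 2" 6] IH(2) m by (simp add: algebra_simps)
    then have "take 9 (drop (nat s) (image_word (window (pos m - 2) 9))) = window (pos n - 2) 9"
      using s by (simp add: take_drop_window pos algebra_simps)
    then have "descend j (window (m - 2) 5, window (pos m - 2) 9) = (window (n - 2) 5, window (pos n - 2) 9)"
      using window_4n[OF m(1) j] by (simp add: descend_def n s_def)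
    then show ?thesis using cl pos s IH(2) n j by simp
  qed
qed

section \<open>The generated sequence is the almost Golomb sequence\<close>

lemma
  assumes "n \<ge> 6"
  shows bits_cell_at_ge_6: "bits (cell_at n)"
    and inc_cell_at_pos_ge_6: "inc (cell_at (pos n)) = 1"
    and aseq_pos_Suc: "aseq (pos (n + 1)) = aseq (pos n) + 1"
proof -
  define r where "r = inc (cell_at (n - 2)) + inc (cell_at (n - 1)) + inc (cell_at n) + inc (cell_at (n + 1))"
  have "sound (window (n - 2) 5, window (pos n - 2) 9)"
    using pairs_sound window_pair[OF assms] unfolding list_all_iff by blast
  then have *: "list_all bits (window (n - 2) 5)" "inc (cell_at (pos n)) = 1" "1 \<le> r" "r \<le> 3"
    "(\<Sum>k\<leftarrow>[0..<nat r]. inc (window (pos n - 2) 9 ! (3 + k))) = 1"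
    by (simp_all add: r_def Let_def algebra_simps)
  show "bits (cell_at n)" using *(1) by (simp add: window_5)
  show "inc (cell_at (pos n)) = 1" by (rule *(2))
  \<comment> \<open>The window at \<open>pos n\<close> reaches to \<open>pos n + 6\<close>, hence the bound on \<open>l\<close>.\<close>
  have "aseq (pos n + int l) = aseq (pos n) + (\<Sum>k\<leftarrow>[0..<l]. inc (window (pos n - 2) 9 ! (3 + k)))"
    if "l \<le> 6" for l
    using that
  proof (induction l)
    case (Suc l)
    then show ?case using window_pair[OF assms] assms aseq_step[of "pos n + int (Suc l)"]
      by (simp add: algebra_simps)
  qed simp
  from this[of "nat r"] * have "aseq (pos n + r) = aseq (pos n) + 1" by simp
  then show "aseq (pos (n + 1)) = aseq (pos n) + 1"
    using pos_step[of n] assms by (simp add: r_def algebra_simps)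
qed

lemma inc_cell_at: "n \<ge> 1 \<Longrightarrow> inc (cell_at n) \<in> {0, 1}"
  using small_cases(1)[of n] bits_cell_at_ge_6[of n] by (cases "n \<le> 6") (auto simp: bits_def)

lemma inc_cell_at_pos: "n \<ge> 3 \<Longrightarrow> inc (cell_at (pos n)) = 1"
  using small_cases(3)[of n] inc_cell_at_pos_ge_6[of n] by (cases "n \<le> 6") auto

lemma pos_gt: "n \<ge> 3 \<Longrightarrow> n < pos n"
  using small_cases(4)[of n] window_pair[of n] by (cases "n \<le> 6") auto

lemma aseq_pos:
  assumes "n \<ge> 1"
  shows "aseq (pos n) = n"
proof (cases "n \<le> 6")
  case True
  then show ?thesis using assms small_cases(2) by blast
next
  case False
  then have "6 \<le> n" by simp
  then show ?thesis
  proof (induction n rule: int_ge_induct)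
    case base
    show ?case by (rule small_cases(2)) simp_all
  next
    case (step n)
    then show ?case using aseq_pos_Suc[of n] by simp
  qed
qed

lemma aseq_pos_minus_1:
  assumes "n \<ge> 3"
  shows "aseq (pos n - 1) = n - 1"
  using aseq_step[of "pos n"] pos_gt[OF assms] inc_cell_at_pos[OF assms] aseq_pos[of n] assms by simp

lemma aseq_mono: "j \<le> k \<Longrightarrow> aseq j \<le> aseq k"
  unfolding aseq_def using inc_cell_at by (intro sum_mono2) force+

lemma golomb4_admissible_aseq: "golomb4_admissible aseq"
  unfolding golomb4_admissible_def
proof (intro conjI allI impI)
  have "aseq 1 = 1" by (simp add: aseq_step aseq_nonpos cell_at.simps)
  then show "golomb4_ext aseq"
    using aseq_nonpos aseq_mono aseq_mono[of 1] by (fastforce simp: golomb4_ext_def)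
  show "golomb4_cond1 aseq"
    using aseq_pos by (simp add: golomb4_cond1_def pos_def)
  fix n :: int assume n: "3 \<le> n"
  have "aseq (m + aseq (n - 1) + aseq (n - 2) + aseq (n - 3)) < n" if "m < aseq n" for m
  proof -
    have "m + aseq (n - 1) + aseq (n - 2) + aseq (n - 3) \<le> pos n - 1"
      using that by (simp add: pos_def)
    from aseq_mono[OF this] show ?thesis using aseq_pos_minus_1[OF n] by simp
  qed
  then show "golomb4_cond2 aseq n" unfolding golomb4_cond2_def by force
qed

text \<open>
  At the first difference \<open>k\<close>, monotonicity leaves \<open>b(k) = aseq(k) - 1\<close> as the only
  smaller value, so \<open>aseq\<close> increases at \<open>k\<close> and, if \<open>n = aseq(k) \<ge> 3\<close>, then \<open>k = s(n)\<close>.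
  As \<open>n < k\<close>, both sequences have the same \<open>s(n)\<close>, and the first condition gives \<open>b(k) = n\<close>.
\<close>
lemma less_fun_aseq:
  assumes b: "golomb4_admissible b" and neq: "b \<noteq> aseq"
  shows "less_fun aseq b"
proof -
  have zero: "b k = 0" if "k \<le> 0" for k
    using b that by (auto simp: golomb4_admissible_def golomb4_ext_def)
  have pos: "b k \<ge> 1" if "k \<ge> 1" for k
    using b that by (force simp: golomb4_admissible_def golomb4_ext_def)
  have mono: "b j \<le> b k" if "1 \<le> j" "j \<le> k" for j k
    using b that by (auto simp: golomb4_admissible_def golomb4_ext_def)
  have eq: "b (b n + b (n - 1) + b (n - 2) + b (n - 3)) = n" if "n \<ge> 1" for n
    using b that by (auto simp: golomb4_admissible_def golomb4_cond1_def)
  obtain k0 where k0: "b k0 \<noteq> aseq k0" using neq by auto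
  define k where "k = int (LEAST i. b (int i) \<noteq> aseq (int i))"
  have "k0 \<ge> 1" using k0 zero[of k0] aseq_nonpos[of k0] by (cases "k0 \<le> 0") auto
  then have "b (int (nat k0)) \<noteq> aseq (int (nat k0))" using k0 by simp
  then have k: "b k \<noteq> aseq k" unfolding k_def by (rule LeastI)
  have below: "b i = aseq i" if "i < k" for i
  proof (cases "i \<le> 0")
    case True
    then show ?thesis using zero aseq_nonpos by simp
  next
    case False
    then show ?thesis using that not_less_Least[of "nat i" "\<lambda>i. b (int i) \<noteq> aseq (int i)"]
      unfolding k_def by auto
  qed
  have k1: "k \<ge> 1" using k zero[of k] aseq_nonpos[of k] by (cases "k \<le> 0") auto
  have small: "aseq 1 = 1" "aseq 2 = 2" by (simp_all add: aseq_step aseq_nonpos cell_at.simps)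
  have "\<not> b k < aseq k"
  proof
    assume lt: "b k < aseq k"
    define n where "n = aseq k"
    have k2: "k \<ge> 2" using lt small pos[of 1] k1 by (cases "k = 1") auto
    have "aseq (k - 1) \<le> b k" using mono[of "k - 1" k] below[of "k - 1"] k2 by simp
    moreover have "aseq k \<le> aseq (k - 1) + 1" using aseq_step[of k] inc_cell_at[of k] k2 by auto
    ultimately have step: "aseq (k - 1) = n - 1" "b k = n - 1" using lt by (auto simp: n_def)
    show False
    proof (cases "n \<ge> 3")
      case True
      have "\<not> k < pos n" using aseq_mono[of k "pos n - 1"] aseq_pos_minus_1[OF True] by (auto simp: n_def)
      moreover have "\<not> pos n \<le> k - 1" using aseq_mono[of "pos n" "k - 1"] aseq_pos[of n] True step by auto
      ultimately have "k = pos n" by simp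
      then have "b n + b (n - 1) + b (n - 2) + b (n - 3) = k"
        using below pos_gt[OF True] by (simp add: pos_def)
      then show False using eq[of n] step True by simp
    next
      case False
      \<comment> \<open>The value 2 starts before \<open>s(2) = 3\<close>, so it needs its own argument: \<open>b(2) = 1\<close> gives \<open>b(b(2) + b(1)) = 1\<close> instead of 2.\<close>
      then have n: "n = 2" using step pos[OF k1] by simp
      have "k = 2" using aseq_mono[of 2 "k - 1"] step small k2 n by (cases "k = 2") auto
      then show False using eq[of 2] below[of 1] step n small zero by simp
    qed
  qed
  then show ?thesis using k below unfolding less_fun_def by (intro exI[of _ k]) auto
qed

lemma almost_golomb4_eq: "almost_golomb4 = aseq"
proof -
  have "golomb4_earliest aseq"
    unfolding golomb4_earliest_def using golomb4_admissible_aseq less_fun_aseq by blast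
  then show ?thesis
    unfolding almost_golomb4_def by (blast intro: the_equality golomb4_earliest_unique)
qed

lemma
  assumes "n \<ge> 5"
  shows eps0_eq: "eps0 n = u0 (cell_at n)"
    and eps1_eq: "eps1 n = u1 (cell_at n)"
    and eps2_eq: "eps2 n = u2 (cell_at n)"
    and eps3_eq: "eps3 n = u3 (cell_at n)"
  using aseq_4n[OF assms] aseq_4n_plus_1[OF assms] aseq_4n_plus_2[OF assms]
    aseq_4n_plus_3[OF assms] assms
  by (simp_all add: eps0_def eps1_def eps2_def eps3_def almost_golomb4_eq Let_def pos_def algebra_simps)

lemmas eps_eq = eps0_eq eps1_eq eps2_eq eps3_eq

lemma bits_cell_at:
  assumes "n \<ge> 5"
  shows "bits (cell_at n)"
proof (cases "n = 5")
  case True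
  then show ?thesis by (simp add: bits_def cell_at.simps)
next
  case False
  then show ?thesis using bits_cell_at_ge_6 assms by simp
qed

section \<open>Automaticity\<close>

text \<open>
  By induction on \<open>i\<close>, every kernel element \<open>n \<mapsto> f(k^i n + j)\<close> is, for \<open>n \<ge> N\<close>, a function of the
  state \<open>v(n)\<close>.  There are finitely many such functions on finitely many states, and finitely many
  ways to choose the values below \<open>N\<close>.
\<close>
lemma automatic_if_state:
  fixes f :: "nat \<Rightarrow> 'a" and v :: "nat \<Rightarrow> 'v"
  assumes k: "k \<ge> 1"
    and fin_f: "finite (range f)" and fin_v: "finite (range v)"
    and out: "\<And>n. n \<ge> N \<Longrightarrow> f n = h (v n)"
    and step: "\<And>n j. n \<ge> N \<Longrightarrow> j < k \<Longrightarrow> v (k * n + j) = T j (v n)"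
  shows "automatic k f"
proof -
  \<comment> \<open>A kernel element is glued from a finite table and a function of the state.\<close>
  define glue where
    "glue = (\<lambda>(p, H) n. if n < N then p n else H (v n) :: 'a)"
  define P where "P = ({..<N} \<rightarrow>\<^sub>E range f) \<times> (v ` {N..} \<rightarrow>\<^sub>E range f)"
  have late: "\<exists>H. \<forall>n\<ge>N. f (k ^ i * n + j) = H (v n)" if "j < k ^ i" for i j
    using that
  proof (induction i arbitrary: j)
    case 0
    then show ?case using out by auto
  next
    case (Suc i)
    define q j' where "q = j div k ^ i" and "j' = j mod k ^ i"
    have ki: "k ^ i > 0" using k by simp
    have j: "j = k ^ i * q + j'" "j' < k ^ i" unfolding q_def j'_def using ki by simp_all
    have q: "q < k" using Suc.prems ki unfolding q_def by (simp add: less_mult_imp_div_less mult.commute)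
    obtain H where H: "\<And>n. n \<ge> N \<Longrightarrow> f (k ^ i * n + j') = H (v n)"
      using Suc.IH[OF j(2)] by blast
    have "f (k ^ Suc i * n + j) = H (T q (v n))" if "n \<ge> N" for n
    proof -
      have "k * n + q \<ge> N" using that k by (metis le_add1 mult_le_mono1 nat_mult_1 order_trans)
      have "k ^ Suc i * n + j = k ^ i * (k * n + q) + j'" by (simp add: j algebra_simps)
      then show ?thesis using H[OF \<open>k * n + q \<ge> N\<close>] step[OF that q] by simp
    qed
    then show ?case by (intro exI[of _ "\<lambda>s. H (T q s)"]) blast
  qed
  have "automatic_kernel k f \<subseteq> glue ` P"
  proof
    fix g assume "g \<in> automatic_kernel k f"
    then obtain i j where g: "g = (\<lambda>n. f (k ^ i * n + j))" and j: "j < k ^ i"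
      unfolding automatic_kernel_def by blast
    obtain H where H: "\<And>n. n \<ge> N \<Longrightarrow> g n = H (v n)" using late[OF j] g by blast
    have "g = glue (restrict g {..<N}, restrict H (v ` {N..}))"
      using H by (auto simp: glue_def fun_eq_iff)
    moreover have "(restrict g {..<N}, restrict H (v ` {N..})) \<in> P"
      using H[symmetric] by (auto simp: P_def g)
    ultimately show "g \<in> glue ` P" by blast
  qed
  moreover have "finite P"
    unfolding P_def using fin_f finite_subset[OF _ fin_v, of "v ` {N..}"]
    by (intro finite_cartesian_product finite_PiE) auto
  ultimately show ?thesis
    unfolding automatic_def using fin_f finite_subset by blast
qed

lemma finite_range_window: "finite (range (\<lambda>n. window (int n - 2) 5))"
proof -
  have "window (int n - 2) 5 \<in> (\<lambda>n. window (int n - 2) 5) ` {..<6} \<union> fst ` set pairs" for n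
    using window_pair[of "int n"] by (cases "n < 6") force+
  then have "range (\<lambda>n. window (int n - 2) 5)
      \<subseteq> (\<lambda>n. window (int n - 2) 5) ` {..<6} \<union> fst ` set pairs" by blast
  then show ?thesis by (rule finite_subset) simp
qed

lemma automatic_eps:
  assumes eq: "\<And>n. n \<ge> 5 \<Longrightarrow> e n = u (cell_at n)" and zero: "\<And>n. n < 5 \<Longrightarrow> e n = (0::int)"
    and bit: "\<And>x. bits x \<Longrightarrow> u x \<in> {0, 1}"
  shows "automatic 4 (\<lambda>n. e (int n))"
proof (rule automatic_if_state)
  have "e (int n) \<in> {0, 1}" for n
    using eq zero bit[OF bits_cell_at] by (cases "int n < 5") auto
  then show "finite (range (\<lambda>n. e (int n)))"
    by (intro finite_subset[of "range _" "{0, 1}"]) auto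
  show "finite (range (\<lambda>n. window (int n - 2) 5))" by (rule finite_range_window)
  show "e (int n) = (\<lambda>ws. u (ws ! 2)) (window (int n - 2) 5)" if "n \<ge> 6" for n
    using that by (simp add: eq)
  show "window (int (4 * n + j) - 2) 5 = (\<lambda>ws. take 5 (drop j (image_word ws))) (window (int n - 2) 5)"
    if "n \<ge> 6" "j < 4" for n j
    using window_4n[of "int n" j] that by simp
qed simp

theorem theorem5p3:
  shows
    "map eps0 [5..23] = [0,1,1,1,1,1,1,1,1,1,1,1,0,1,0,1,1,0,1] \<and>
     map eps1 [5..23] = [1,0,0,0,0,0,0,0,0,0,0,0,1,0,1,0,0,1,0] \<and>
     map eps2 [5..23] = [1,1,1,1,1,1,1,1,1,1,1,0,1,0,1,1,0,1,0] \<and>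
     map eps3 [5..23] = [0,0,0,0,0,0,0,0,0,0,0,1,0,1,0,0,1,0,1] \<and>
     (\<forall>m\<ge>6.
        eps0 (4*m) = (1 - eps0 m) * eps0 (m + 1) + eps0 m * eps0 (m - 1) \<and>
        eps0 (4*m + 1) = (1 - eps0 m) * eps0 (m - 1) + eps0 m * eps0 (m + 1) \<and>
        eps0 (4*m + 2) = eps0 m \<and>
        eps0 (4*m + 3) = eps0 (m + 1) \<and>
        eps1 (4*m) = eps2 m * bit_xor (eps1 (m - 1)) (eps1 (m + 1)) \<and>
        eps1 (4*m + 1) = 1 - eps2 m \<and>
        eps1 (4*m + 2) = eps1 m \<and>
        eps1 (4*m + 3) = eps1 (m + 1) \<and>
        eps2 (4*m) = (1 - eps0 (m - 1)) * eps1 (m - 1)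
                       + eps0 (m - 1) * (1 - eps1 (m - 1)) * eps2 m \<and>
        eps2 (4*m + 1) = eps2 (m - 1) \<and>
        eps2 (4*m + 2) = eps2 m \<and>
        eps2 (4*m + 3) = 1 - eps1 m \<and>
        eps3 (4*m) = eps2 (m - 1) * bit_xnor (eps2 m) (eps1 m) \<and>
        eps3 (4*m + 1) = eps3 (m - 1) \<and>
        eps3 (4*m + 2) = eps3 m \<and>
        eps3 (4*m + 3) = (1 - eps1 (m + 1)) * bit_xnor (eps2 m) (eps1 m)) \<and>
     (\<forall>n\<ge>5. eps0 n \<in> {0, 1} \<and> eps1 n \<in> {0, 1} \<and> eps2 n \<in> {0, 1} \<and> eps3 n \<in> {0, 1}) \<and>
     automatic 4 (\<lambda>n. eps0 (int n)) \<and> automatic 4 (\<lambda>n. eps1 (int n)) \<and>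
     automatic 4 (\<lambda>n. eps2 (int n)) \<and> automatic 4 (\<lambda>n. eps3 (int n))"
proof (intro conjI)
  show "map eps0 [5..23] = [0,1,1,1,1,1,1,1,1,1,1,1,0,1,0,1,1,0,1]"
    and "map eps1 [5..23] = [1,0,0,0,0,0,0,0,0,0,0,0,1,0,1,0,0,1,0]"
    and "map eps2 [5..23] = [1,1,1,1,1,1,1,1,1,1,1,0,1,0,1,1,0,1,0]"
    and "map eps3 [5..23] = [0,0,0,0,0,0,0,0,0,0,0,1,0,1,0,0,1,0,1]"
    by (simp_all add: upto_rec1 eps_eq cell_at.simps)
  have shift: "4 * (m + 1) - 2 = 4 * m + 2" "4 * (m + 1) - 1 = 4 * m + 3" for m :: int by simp_all
  show "\<forall>m\<ge>6.
        eps0 (4*m) = (1 - eps0 m) * eps0 (m + 1) + eps0 m * eps0 (m - 1) \<and>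
        eps0 (4*m + 1) = (1 - eps0 m) * eps0 (m - 1) + eps0 m * eps0 (m + 1) \<and>
        eps0 (4*m + 2) = eps0 m \<and>
        eps0 (4*m + 3) = eps0 (m + 1) \<and>
        eps1 (4*m) = eps2 m * bit_xor (eps1 (m - 1)) (eps1 (m + 1)) \<and>
        eps1 (4*m + 1) = 1 - eps2 m \<and>
        eps1 (4*m + 2) = eps1 m \<and>
        eps1 (4*m + 3) = eps1 (m + 1) \<and>
        eps2 (4*m) = (1 - eps0 (m - 1)) * eps1 (m - 1)
                       + eps0 (m - 1) * (1 - eps1 (m - 1)) * eps2 m \<and>
        eps2 (4*m + 1) = eps2 (m - 1) \<and>
        eps2 (4*m + 2) = eps2 m \<and>
        eps2 (4*m + 3) = 1 - eps1 m \<and>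
        eps3 (4*m) = eps2 (m - 1) * bit_xnor (eps2 m) (eps1 m) \<and>
        eps3 (4*m + 1) = eps3 (m - 1) \<and>
        eps3 (4*m + 2) = eps3 m \<and>
        eps3 (4*m + 3) = (1 - eps1 (m + 1)) * bit_xnor (eps2 m) (eps1 m)"
    using cell_at_4m cell_at_4m_plus_1 cell_at_4m_minus_2[of "m + 1" for m, unfolded shift]
      cell_at_4m_minus_1[of "m + 1" for m, unfolded shift]
    by (simp add: eps_eq block_def Let_def)
  show "\<forall>n\<ge>5. eps0 n \<in> {0, 1} \<and> eps1 n \<in> {0, 1} \<and> eps2 n \<in> {0, 1} \<and> eps3 n \<in> {0, 1}"
    using bits_cell_at by (simp add: eps_eq bits_def)
  show "automatic 4 (\<lambda>n. eps0 (int n))" "automatic 4 (\<lambda>n. eps1 (int n))"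
    "automatic 4 (\<lambda>n. eps2 (int n))" "automatic 4 (\<lambda>n. eps3 (int n))"
    by (rule automatic_eps, erule eps_eq,
        simp add: eps0_def eps1_def eps2_def eps3_def Let_def, simp add: bits_def)+
qed

end
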